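(* Let the solution subspace be $\mathcal{S}_k=\mathrm{span}\{W_k\}$, where $W_k=(w_1,\dots,w_k)$ is generated by $k$ steps of the preconditioned Golub-Kahan bidiagonalization. Then $$\mathcal{S}_k=\mathrm{span}\{Z(D_\alpha^{-1}D_A^TD_A)^iD_\alpha^{-1}D_A^TU_A^Tb\}_{i=0}^{k-1}.$$
   Context: Setting. $A\in\mathbb{R}^{m\times n}$, $b\in\mathbb{R}^m$, $M\in\mathbb{R}^{n\times n}$ is symmetric positive semidefinite, written $M=L^TL$ with $L\in\mathbb{R}^{p\times n}$, $p\le n$, $\mathrm{rank}(L)=p$. It is assumed that $\mathcal{N}(A)\cap\mathcal{N}(L)=\{\mathbf 0\}$. Let $\alpha>0$ and $G=A^TA+\alpha M$, which is symmetric positive definite; $\|x\|_G=(x^TGx)^{1/2}$. GSVD of $\{A,L\}$: $A=U_AD_AZ^{-1}$, $L=U_LD_LZ^{-1}$ with $U_A\in\mathbb{R}^{m\times m}$, $U_L\in\mathbb{R}^{p\times p}$ orthogonal, $Z\in\mathbb{R}^{n\times n}$ invertible, and block diagonal (possibly with empty blocks) $D_A=\mathrm{diag}(I_A,\Sigma_A,O_A)\in\mathbb{R}^{m\times n}$ with row block sizes $r,\,q,\,m-r-q$, and $D_L=\mathrm{diag}(O_L,\Sigma_L,I_L)\in\mathbb{R}^{p\times n}$ with row block sizes $p+r-n,\,q,\,n-r-q$; the column block sizes of both are $r,\,q,\,n-r-q$. Here $I_A,I_L$ are identity matrices, $O_A,O_L$ are zero matrices, $\Sigma_A=\mathrm{diag}(\sigma_{r+1},\dots,\sigma_{r+q})$,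 $\Sigma_L=\mathrm{diag}(\rho_{r+1},\dots,\rho_{r+q})$, $1>\sigma_{r+1}\ge\dots\ge\sigma_{r+q}>0$, $0<\rho_{r+1}\le\dots\le\rho_{r+q}<1$, $\sigma_i^2+\rho_i^2=1$. Define the $n\times n$ diagonal matrix $$D_\alpha=\mathrm{diag}(\underbrace{1,\dots,1}_{r},\ \underbrace{\sigma_{r+1}^2+\alpha\rho_{r+1}^2,\dots,\sigma_{r+q}^2+\alpha\rho_{r+q}^2}_{q},\ \underbrace{\alpha,\dots,\alpha}_{n-r-q}).$$ Preconditioned Golub-Kahan bidiagonalization (pGKB). With $w_0=\mathbf 0$, the process is $\beta_1u_1=b$, $\alpha_1w_1=G^{-1}A^Tu_1$, and for $i\ge1$: $\beta_{i+1}u_{i+1}=Aw_i-\alpha_iu_i$, $\alpha_{i+1}w_{i+1}=G^{-1}A^Tu_{i+1}-\beta_{i+1}w_i$, where the scalars $\alpha_i,\beta_i\ge0$ are the norms making $\|u_i\|_2=\|w_i\|_G=1$. (The scalars $\alpha_i$ are distinct from the parameter $\alpha$.) It is assumed that the process does not terminate within $k$ steps, i.e. $\alpha_i,\beta_i\ne0$ for $1\le i\le k$. $\mathrm{span}\{W_k\}$ denotes the span of the columns of $W_k$. *)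

theory Defs
  imports "Jordan_Normal_Form.DL_Rank" "Jordan_Normal_Form.Matrix_Kernel"
    "Jordan_Normal_Form.Gauss_Jordan_Elimination"
begin

(* Unspecified for singular arguments; mat_inverse returns an option. *)
definition minv :: "real mat \<Rightarrow> real mat" where
  "minv A = the (mat_inverse A)"

definition norm2 :: "real vec \<Rightarrow> real" where
  "norm2 x = sqrt (x \<bullet> x)"

definition normG :: "real mat \<Rightarrow> real vec \<Rightarrow> real" where
  "normG G x = sqrt (x \<bullet> (G *\<^sub>v x))"

definition sym_psd :: "nat \<Rightarrow> real mat \<Rightarrow> bool" where
  "sym_psd n M \<longleftrightarrow> M \<in> carrier_mat n n \<and> M\<^sup>T = M \<and>
     (\<forall>x \<in> carrier_vec n. 0 \<le> x \<bullet> (M *\<^sub>v x))"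

(* The library's orthogonal_mat only asks for pairwise orthogonal columns, not for unit columns. *)
definition orthogonal_matrix :: "nat \<Rightarrow> real mat \<Rightarrow> bool" where
  "orthogonal_matrix n U \<longleftrightarrow> U \<in> carrier_mat n n \<and> U\<^sup>T * U = 1\<^sub>m n \<and> U * U\<^sup>T = 1\<^sub>m n"

(* Matrix positions are counted from 0, whereas the sequences \<sigma> and \<rho> keep their
   one-based indices r+1, ..., r+q. The natural-number differences below are meant for
   r + q \<le> m, r + q \<le> n and n \<le> p + r, as imposed in gsvd. *)
definition D_A :: "nat \<Rightarrow> nat \<Rightarrow> nat \<Rightarrow> nat \<Rightarrow> (nat \<Rightarrow> real) \<Rightarrow> real mat" where
  "D_A m n r q \<sigma> = diag_block_mat
     [1\<^sub>m r, mat_diag q (\<lambda>j. \<sigma> (r + 1 + j)), 0\<^sub>m (m - r - q) (n - r - q)]"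

definition D_L :: "nat \<Rightarrow> nat \<Rightarrow> nat \<Rightarrow> nat \<Rightarrow> (nat \<Rightarrow> real) \<Rightarrow> real mat" where
  "D_L p n r q \<rho> = diag_block_mat
     [0\<^sub>m (p + r - n) r, mat_diag q (\<lambda>j. \<rho> (r + 1 + j)), 1\<^sub>m (n - r - q)]"

definition D_alpha ::
  "nat \<Rightarrow> nat \<Rightarrow> nat \<Rightarrow> (nat \<Rightarrow> real) \<Rightarrow> (nat \<Rightarrow> real) \<Rightarrow> real \<Rightarrow> real mat" where
  "D_alpha n r q \<sigma> \<rho> \<alpha> = diag_block_mat
     [1\<^sub>m r, mat_diag q (\<lambda>j. (\<sigma> (r + 1 + j))\<^sup>2 + \<alpha> * (\<rho> (r + 1 + j))\<^sup>2),
      mat_diag (n - r - q) (\<lambda>_. \<alpha>)]"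

definition gsvd ::
  "nat \<Rightarrow> nat \<Rightarrow> nat \<Rightarrow> real mat \<Rightarrow> real mat \<Rightarrow> nat \<Rightarrow> nat \<Rightarrow> (nat \<Rightarrow> real) \<Rightarrow> (nat \<Rightarrow> real) \<Rightarrow>
   real mat \<Rightarrow> real mat \<Rightarrow> real mat \<Rightarrow> bool" where
  "gsvd m n p A L r q \<sigma> \<rho> U\<^sub>A U\<^sub>L Z \<longleftrightarrow>
     r + q \<le> m \<and> r + q \<le> n \<and> n \<le> p + r \<and>
     orthogonal_matrix m U\<^sub>A \<and> orthogonal_matrix p U\<^sub>L \<and>
     Z \<in> carrier_mat n n \<and> invertible_mat Z \<and>
     (\<forall>i\<in>{r+1..r+q}. 0 < \<sigma> i \<and> \<sigma> i < 1 \<and> 0 < \<rho> i \<and> \<rho> i < 1 \<and> (\<sigma> i)\<^sup>2 + (\<rho> i)\<^sup>2 = 1) \<and>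
     (\<forall>i\<in>{r+1..r+q}. \<forall>j\<in>{r+1..r+q}. i \<le> j \<longrightarrow> \<sigma> j \<le> \<sigma> i \<and> \<rho> i \<le> \<rho> j) \<and>
     A = U\<^sub>A * D_A m n r q \<sigma> * minv Z \<and>
     L = U\<^sub>L * D_L p n r q \<rho> * minv Z"

(* The vectors u_i, w_i and the scalars \<alpha>_i (here a i, apart from the parameter \<alpha>), \<beta>_i are produced by the first k \<ge> 1 steps of
   preconditioned Golub-Kahan bidiagonalization, up to and including u_k and w_k. The scalars
   are nonnegative and normalize the vectors, so while they are nonzero the recurrences
   determine all four sequences. *)
definition pgkb ::
  "nat \<Rightarrow> nat \<Rightarrow> real mat \<Rightarrow> real mat \<Rightarrow> real vec \<Rightarrow> nat \<Rightarrow>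
   (nat \<Rightarrow> real vec) \<Rightarrow> (nat \<Rightarrow> real vec) \<Rightarrow> (nat \<Rightarrow> real) \<Rightarrow> (nat \<Rightarrow> real) \<Rightarrow> bool" where
  "pgkb m n A G b k u w a \<beta> \<longleftrightarrow>
     w 0 = 0\<^sub>v n \<and>
     (\<forall>i\<in>{1..k}. u i \<in> carrier_vec m \<and> norm2 (u i) = 1 \<and> 0 \<le> \<beta> i \<and>
                  w i \<in> carrier_vec n \<and> normG G (w i) = 1 \<and> 0 \<le> a i) \<and>
     \<beta> 1 \<cdot>\<^sub>v u 1 = b \<and>
     a 1 \<cdot>\<^sub>v w 1 = minv G * A\<^sup>T *\<^sub>v u 1 \<and>
     (\<forall>i. 1 \<le> i \<and> i < k \<longrightarrow>
        \<beta> (i + 1) \<cdot>\<^sub>v u (i + 1) = A *\<^sub>v w i - a i \<cdot>\<^sub>v u i \<and>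
        a (i + 1) \<cdot>\<^sub>v w (i + 1) = minv G * A\<^sup>T *\<^sub>v u (i + 1) - \<beta> (i + 1) \<cdot>\<^sub>v w i)"

abbreviation vspan :: "nat \<Rightarrow> real vec set \<Rightarrow> real vec set" where
  "vspan n \<equiv> LinearCombinations.module.span class_ring (module_vec TYPE(real) n)"

end

theory Submission
  imports Defs
begin

text \<open>
Put \<open>C = G\<^sup>-\<^sup>1 A\<^sup>T A\<close>. The process produces, like the Lanczos process, a basis of the
Krylov space of \<open>C\<close> generated by \<open>G\<^sup>-\<^sup>1 A\<^sup>T b\<close>. Eliminating the vectors \<open>u\<^sub>i\<close> from
the recurrences leaves
\<open>C w\<^sub>j = a\<^bsub>j+1\<^esub> \<beta>\<^bsub>j+1\<^esub> w\<^bsub>j+1\<^esub> + (a\<^sub>j\<^sup>2 + \<beta>\<^bsub>j+1\<^esub>\<^sup>2) w\<^sub>j + a\<^sub>j \<beta>\<^sub>j w\<^bsub>j-1\<^esub>\<close>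
(lemma \<open>pgkb_three_term_recurrence\<close>), and \<open>w\<^sub>1\<close> is a nonzero multiple of
\<open>G\<^sup>-\<^sup>1 A\<^sup>T b\<close>. The coefficients of \<open>w\<^bsub>j+1\<^esub>\<close> do not vanish, so the first \<open>k\<close>
vectors \<open>w\<^sub>j\<close> and the first \<open>k\<close> Krylov vectors generate each other
(lemma \<open>span_three_term_recurrence_eq_krylov\<close>).

The decomposition of \<open>{A, L}\<close> then makes the Krylov vectors explicit. It diagonalizes
\<open>A\<^sup>T A\<close> and \<open>L\<^sup>T L\<close> by the same congruence, hence also
\<open>G = Z\<^sup>-\<^sup>T D\<^sub>\<alpha> Z\<^sup>-\<^sup>1\<close>, which gives
\<open>G\<^sup>-\<^sup>1 A\<^sup>T = Z D\<^sub>\<alpha>\<^sup>-\<^sup>1 D\<^sub>A\<^sup>T U\<^sub>A\<^sup>T\<close> (lemma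
\<open>gsvd_minv_gram_mult_transpose\<close>) and \<open>C = Z E Z\<^sup>-\<^sup>1\<close> with
\<open>E = D\<^sub>\<alpha>\<^sup>-\<^sup>1 D\<^sub>A\<^sup>T D\<^sub>A\<close>. Therefore
\<open>C\<^sup>i G\<^sup>-\<^sup>1 A\<^sup>T b = Z E\<^sup>i D\<^sub>\<alpha>\<^sup>-\<^sup>1 D\<^sub>A\<^sup>T U\<^sub>A\<^sup>T b\<close>.
\<close>

section \<open>Three-term recurrences and Krylov spaces\<close>

text \<open>The vectors that \<open>C\<close> sends into \<open>span Y\<close> form a submodule, so a
submodule containing \<open>X\<close> contains \<open>span X\<close>.\<close>

lemma (in vec_space) mult_mat_vec_span:
  assumes C: "C \<in> carrier_mat n n" and X: "X \<subseteq> carrier_vec n" and Y: "Y \<subseteq> carrier_vec n"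
    and XY: "\<And>x. x \<in> X \<Longrightarrow> C *\<^sub>v x \<in> span Y"
    and x: "x \<in> span X"
  shows "C *\<^sub>v x \<in> span Y"
proof -
  let ?N = "{x \<in> carrier_vec n. C *\<^sub>v x \<in> span Y}"
  have zero: "0\<^sub>v n \<in> span Y"
    using submodule.zero_closed[OF span_is_submodule, of Y] Y by (simp add: module_vec_simps)
  have C0: "C *\<^sub>v 0\<^sub>v n = 0\<^sub>v n"
    using C by auto
  have N: "submodule class_ring ?N V"
  proof (unfold_locales)
    show "?N \<subseteq> carrier V" by auto
    show "\<zero>\<^bsub>V\<^esub> \<in> ?N"
      using zero C0 by (simp add: module_vec_simps)
  next
    fix v w assume "v \<in> ?N" "w \<in> ?N"
    then show "v \<oplus>\<^bsub>V\<^esub> w \<in> ?N"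
      using span_add1[of Y] Y C by (auto simp: module_vec_simps mult_add_distrib_mat_vec[OF C])
  next
    fix c :: 'a and v assume "c \<in> carrier class_ring" "v \<in> ?N"
    then show "c \<odot>\<^bsub>V\<^esub> v \<in> ?N"
      using smult_in_span[OF Y] by (auto simp: module_vec_simps mult_mat_vec[OF C])
  qed
  have "X \<subseteq> ?N" using X XY by auto
  then have "span X \<subseteq> ?N"
    by (rule span_is_subset[OF _ N])
  then show ?thesis using x by auto
qed

text \<open>
The recurrence can be read in two ways. As a formula for \<open>C w\<^sub>j\<close> it says that \<open>C\<close> moves
the span of the first \<open>i + 1\<close> vectors \<open>w\<^sub>j\<close> into the span of the first \<open>i + 2\<close>, so that
\<open>y\<^sub>i = C\<^sup>i y\<^sub>0\<close> is a combination of \<open>w\<^sub>1, \<dots>, w\<^bsub>i+1\<^esub>\<close>. Solved for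
\<open>w\<^bsub>j+1\<^esub>\<close>, which needs \<open>\<gamma>\<^sub>j \<noteq> 0\<close>, it makes \<open>w\<^sub>j\<close> a combination of
\<open>y\<^sub>0, \<dots>, y\<^bsub>j-1\<^esub>\<close> by induction. The convention \<open>w\<^sub>0 = 0\<close> gives the case
\<open>j = 1\<close> the same shape as the others.\<close>

lemma (in vec_space) span_three_term_recurrence_eq_krylov:
  fixes w y :: "nat \<Rightarrow> 'a vec"
  assumes C: "C \<in> carrier_mat n n"
    and w: "\<And>j. 1 \<le> j \<Longrightarrow> j \<le> k \<Longrightarrow> w j \<in> carrier_vec n" and w0: "w 0 = 0\<^sub>v n"
    and y: "\<And>i. y i \<in> carrier_vec n" "\<And>i. y (Suc i) = C *\<^sub>v y i"
    and start: "1 \<le> k" "y 0 = c \<cdot>\<^sub>v w 1" "c \<noteq> 0"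
    and rec: "\<And>j. 1 \<le> j \<Longrightarrow> j < k \<Longrightarrow> \<gamma> j \<noteq> 0 \<and>
      C *\<^sub>v w j = \<gamma> j \<cdot>\<^sub>v w (j + 1) + \<delta> j \<cdot>\<^sub>v w j + \<epsilon> j \<cdot>\<^sub>v w (j - 1)"
  shows "span (w ` {1..k}) = span (y ` {..<k})"
proof -
  have add: "u + v \<in> span S" if "S \<subseteq> carrier_vec n" "u \<in> span S" "v \<in> span S" for u v S
    using span_add1[OF _ that(2,3)] that(1) by (simp add: module_vec_simps)
  have mem: "v \<in> span S" if "S \<subseteq> carrier_vec n" "v \<in> S" for v S
    using span_mem[of S v] that by simp
  have zero: "0\<^sub>v n \<in> span S" if "S \<subseteq> carrier_vec n" for S
    using submodule.zero_closed[OF span_is_submodule, of S] that by (simp add: module_vec_simps)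
  have wc: "w j \<in> carrier_vec n" if "j \<le> k" for j
    using that w[of j] w0 by (cases j) auto
  have W: "w ` {1..j} \<subseteq> carrier_vec n" if "j \<le> k" for j
    using that by (auto intro!: wc)
  have Y: "y ` S \<subseteq> carrier_vec n" for S
    using y(1) by auto
  have "y i \<in> span (w ` {1..i + 1})" if "i < k" for i
    using that
  proof (induction i)
    case 0
    have "w 1 \<in> span (w ` {1..1})"
      by (rule mem) (use W[of 1] start(1) in auto)
    then show ?case
      using smult_in_span[OF W[of 1]] start(1,2) by simp
  next
    case (Suc i)
    let ?S = "w ` {1..Suc i + 1}"
    have S: "?S \<subseteq> carrier_vec n"
      using Suc.prems by (intro W) simp
    have ws: "w j \<in> span ?S" if "j \<le> Suc i + 1" for j
      using that zero[OF S] w0 mem[OF S, of "w j"] by (cases "j = 0") auto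
    have step: "C *\<^sub>v x \<in> span ?S" if "x \<in> w ` {1..i + 1}" for x
    proof -
      from that obtain j where j: "x = w j" "1 \<le> j" "j \<le> i + 1" by auto
      have "C *\<^sub>v w j = \<gamma> j \<cdot>\<^sub>v w (j + 1) + \<delta> j \<cdot>\<^sub>v w j + \<epsilon> j \<cdot>\<^sub>v w (j - 1)"
        using rec[of j] j Suc.prems by simp
      moreover have "w (j + 1) \<in> span ?S" "w j \<in> span ?S" "w (j - 1) \<in> span ?S"
        using ws[of "j + 1"] ws[of j] ws[of "j - 1"] j(2,3) by simp_all
      ultimately show ?thesis
        unfolding j(1) by (simp only: add[OF S] smult_in_span[OF S])
    qed
    have "w ` {1..i + 1} \<subseteq> carrier_vec n" "y i \<in> span (w ` {1..i + 1})"
      using Suc W[of "i + 1"] by simp_all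
    from mult_mat_vec_span[OF C this(1) S step this(2)] have "C *\<^sub>v y i \<in> span ?S" .
    then show ?case using y(2) by simp
  qed
  moreover have "span (w ` {1..i + 1}) \<subseteq> span (w ` {1..k})" if "i < k" for i
    using that by (intro span_is_monotone image_mono) auto
  ultimately have "y ` {..<k} \<subseteq> span (w ` {1..k})" by blast
  then have *: "span (y ` {..<k}) \<subseteq> span (w ` {1..k})"
    using W[of k] by (intro span_subsetI) auto
  have "w j \<in> span (y ` {..<j})" if "j \<le> k" for j
    using that
  proof (induction j rule: less_induct)
    case (less j)
    consider "j = 0" | "j = 1" | i where "j = i + 1" "1 \<le> i"
      by (metis Suc_eq_plus1 One_nat_def not_less_eq_eq not0_implies_Suc le0)
    then show ?case
    proof cases
      case 1
      then show ?thesis using zero[of "{}"] w0 by simp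
    next
      case 2
      have "w 1 = inverse c \<cdot>\<^sub>v y 0"
        using start by (simp add: smult_smult_assoc)
      moreover have "y 0 \<in> span (y ` {..<1})"
        by (rule mem[OF Y]) simp
      ultimately show ?thesis
        using smult_in_span[OF Y] 2 by simp
    next
      case 3
      let ?S = "y ` {..<i + 1}"
      have sub: "span (y ` {..<l}) \<subseteq> span ?S" if "l \<le> i + 1" for l
        using that by (intro span_is_monotone image_mono) auto
      have Cw: "C *\<^sub>v w i \<in> span ?S"
      proof (rule mult_mat_vec_span[OF C Y Y])
        show "w i \<in> span (y ` {..<i})" using less 3 by simp
        show "C *\<^sub>v x \<in> span ?S" if "x \<in> y ` {..<i}" for x
          using that by (auto simp: y(2)[symmetric] intro!: mem[OF Y])
      qed
      have wi: "w i \<in> span ?S" "w (i - 1) \<in> span ?S"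
        using less.IH[of i] less.IH[of "i - 1"] less.prems 3 subsetD[OF sub[of i]]
          subsetD[OF sub[of "i - 1"]] by simp_all
      have c: "w i \<in> carrier_vec n" "w (i + 1) \<in> carrier_vec n" "w (i - 1) \<in> carrier_vec n"
        using less.prems 3 by (auto intro!: wc)
      have r: "\<gamma> i \<noteq> 0" "C *\<^sub>v w i = \<gamma> i \<cdot>\<^sub>v w (i + 1) + \<delta> i \<cdot>\<^sub>v w i + \<epsilon> i \<cdot>\<^sub>v w (i - 1)"
        using rec[of i] less.prems 3 by auto
      have "w (i + 1) = inverse (\<gamma> i) \<cdot>\<^sub>v
          (C *\<^sub>v w i + ((- \<delta> i) \<cdot>\<^sub>v w i + (- \<epsilon> i) \<cdot>\<^sub>v w (i - 1)))"
        unfolding r(2) using c r(1) by (intro eq_vecI) (auto simp: field_simps)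
      also have "\<dots> \<in> span ?S"
        using Cw wi by (intro smult_in_span[OF Y] add[OF Y])
      finally show ?thesis using 3 by simp
    qed
  qed
  moreover have "span (y ` {..<j}) \<subseteq> span (y ` {..<k})" if "j \<le> k" for j
    using that by (intro span_is_monotone image_mono) auto
  ultimately have "w j \<in> span (y ` {..<k})" if "j \<le> k" for j
    using that by blast
  then have "w ` {1..k} \<subseteq> span (y ` {..<k})" by auto
  then have "span (w ` {1..k}) \<subseteq> span (y ` {..<k})"
    by (intro span_subsetI Y)
  with * show ?thesis by blast
qed

text \<open>Applying \<open>B = G\<^sup>-\<^sup>1 A\<^sup>T\<close> to the recurrence for \<open>u\<^bsub>j+1\<^esub>\<close> expresses
\<open>B A w\<^sub>j\<close> by \<open>B u\<^bsub>j+1\<^esub>\<close> and \<open>B u\<^sub>j\<close>; the recurrence for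
\<open>w\<close> expresses these two by \<open>w\<^bsub>j+1\<^esub>\<close>, \<open>w\<^sub>j\<close> and
\<open>w\<^bsub>j-1\<^esub>\<close>. This eliminates the vectors \<open>u\<close>.\<close>

lemma pgkb_three_term_recurrence:
  assumes pgkb: "pgkb m n A G b k u w a \<beta>" and A: "A \<in> carrier_mat m n"
    and G: "minv G \<in> carrier_mat n n" and j: "1 \<le> j" "j < k"
  shows "(minv G * A\<^sup>T * A) *\<^sub>v w j =
    (\<beta> (j + 1) * a (j + 1)) \<cdot>\<^sub>v w (j + 1) + ((a j)\<^sup>2 + (\<beta> (j + 1))\<^sup>2) \<cdot>\<^sub>v w j
      + (a j * \<beta> j) \<cdot>\<^sub>v w (j - 1)"
proof -
  let ?B = "minv G * A\<^sup>T"
  note P = pgkb[unfolded pgkb_def]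
  have B: "?B \<in> carrier_mat n m" using A G by auto
  have u: "u i \<in> carrier_vec m" if "1 \<le> i" "i \<le> k" for i using P that by auto
  have w: "w i \<in> carrier_vec n" if "i \<le> k" for i using P that by (cases "i = 0") auto
  have c: "u j \<in> carrier_vec m" "u (j + 1) \<in> carrier_vec m"
    "w (j - 1) \<in> carrier_vec n" "w j \<in> carrier_vec n" "w (j + 1) \<in> carrier_vec n"
    using j by (auto intro!: u w)
  have solve: "x = z + y" if "z = x - y" "x \<in> carrier_vec l" "y \<in> carrier_vec l"
    for x y z :: "real vec" and l
    using that by (intro eq_vecI) auto
  have Bu: "?B *\<^sub>v u (i + 1) = a (i + 1) \<cdot>\<^sub>v w (i + 1) + \<beta> (i + 1) \<cdot>\<^sub>v w i" if "i < k" for i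
  proof -
    have c: "?B *\<^sub>v u (i + 1) \<in> carrier_vec n" "w i \<in> carrier_vec n"
      using B u[of "i + 1"] w[of i] that by (auto intro!: mult_mat_vec_carrier)
    have "a (i + 1) \<cdot>\<^sub>v w (i + 1) = ?B *\<^sub>v u (i + 1) - \<beta> (i + 1) \<cdot>\<^sub>v w i"
    \<comment> \<open>The starting equation for \<open>w 1\<close> has no subtracted term, which agrees with \<open>w 0 = 0\<close>.\<close>
    proof (cases "i = 0")
      case True
      have "\<beta> 1 \<cdot>\<^sub>v 0\<^sub>v n = (0\<^sub>v n :: real vec)" by auto
      then show ?thesis using P c True by simp
    next
      case False
      then show ?thesis using P that by auto
    qed
    then show ?thesis using c by (intro solve[of _ _ _ n]) auto
  qed
  have "\<beta> (j + 1) \<cdot>\<^sub>v u (j + 1) = A *\<^sub>v w j - a j \<cdot>\<^sub>v u j"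
    using P j by auto
  moreover have "A *\<^sub>v w j \<in> carrier_vec m" using A c by simp
  ultimately have Aw: "A *\<^sub>v w j = \<beta> (j + 1) \<cdot>\<^sub>v u (j + 1) + a j \<cdot>\<^sub>v u j"
    using c by (intro solve[of _ _ _ m]) auto
  have "(?B * A) *\<^sub>v w j = ?B *\<^sub>v (A *\<^sub>v w j)"
    using assoc_mult_mat_vec[OF B A] c by simp
  also have "\<dots> = \<beta> (j + 1) \<cdot>\<^sub>v (?B *\<^sub>v u (j + 1)) + a j \<cdot>\<^sub>v (?B *\<^sub>v u j)"
    unfolding Aw using c by (simp add: mult_add_distrib_mat_vec[OF B] mult_mat_vec[OF B])
  also have "?B *\<^sub>v u (j + 1) = a (j + 1) \<cdot>\<^sub>v w (j + 1) + \<beta> (j + 1) \<cdot>\<^sub>v w j"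
    using Bu[of j] j by simp
  also have "?B *\<^sub>v u j = a j \<cdot>\<^sub>v w j + \<beta> j \<cdot>\<^sub>v w (j - 1)"
    using Bu[of "j - 1"] j by simp
  finally show ?thesis
    using c by (auto simp: power2_eq_square algebra_simps)
qed

section \<open>Matrix inverses and block diagonal matrices\<close>

text \<open>Stated by dimensions instead of carrier sets, associativity and the transpose of a product become
conditional rewrite rules whose side conditions the simplifier can decide for long products.\<close>

lemma assoc_mult_mat_dim:
  fixes A :: "'a::semiring_0 mat"
  assumes "dim_col A = dim_row B" "dim_col B = dim_row C"
  shows "A * B * C = A * (B * C)"
  by (rule assoc_mult_mat[of _ "dim_row A" "dim_col A" _ "dim_col B" _ "dim_col C"]) (use assms in auto)

lemma transpose_mult_dim:
  fixes A :: "'a::comm_semiring_0 mat"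
  assumes "dim_col A = dim_row B"
  shows "(A * B)\<^sup>T = B\<^sup>T * A\<^sup>T"
  by (rule transpose_mult[of _ "dim_row A" "dim_col A" _ "dim_col B"]) (use assms in auto)

text \<open>A right inverse of a square matrix is its inverse; in particular the Gauss-Jordan algorithm
behind \<open>minv\<close> succeeds and returns it.\<close>

lemma minv_eqI:
  assumes A: "A \<in> carrier_mat n n" and B: "B \<in> carrier_mat n n" and AB: "A * B = 1\<^sub>m n"
  shows "minv A = B"
proof -
  have BA: "B * A = 1\<^sub>m n"
    using mat_mult_left_right_inverse[OF A B AB] .
  then have "A \<in> Units (ring_mat TYPE(real) n ())"
    using A B AB by (auto simp: Units_def ring_mat_def)
  then obtain B' where inv: "mat_inverse A = Some B'"
    using mat_inverse(1)[OF A, of "()"] by (cases "mat_inverse A") auto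
  from mat_inverse(2)[OF A inv] have B': "B' * A = 1\<^sub>m n" "B' \<in> carrier_mat n n"
    by simp_all
  have "B' = B' * (A * B)" using B'(2) AB by simp
  also have "\<dots> = (B' * A) * B" using assoc_mult_mat[OF B'(2) A B] by simp
  also have "\<dots> = B" using B'(1) B by simp
  finally show ?thesis using inv by (simp add: minv_def)
qed

lemma invertible_mat_minv:
  assumes A: "A \<in> carrier_mat n n" and "invertible_mat A"
  shows "minv A \<in> carrier_mat n n" "A * minv A = 1\<^sub>m n" "minv A * A = 1\<^sub>m n"
proof -
  obtain B where B: "A * B = 1\<^sub>m (dim_row A)" "B * A = 1\<^sub>m (dim_row B)"
    using assms(2) by (auto simp: invertible_mat_def inverts_mat_def)
  have dim: "dim_row B = n" "dim_col B = n"
    using B A by (metis carrier_matD index_mult_mat(2,3) index_one_mat(2,3))+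
  then have Bc: "B \<in> carrier_mat n n" by auto
  have "minv A = B"
    using minv_eqI[OF A Bc] B(1) A by simp
  then show "minv A \<in> carrier_mat n n" "A * minv A = 1\<^sub>m n" "minv A * A = 1\<^sub>m n"
    using Bc B A dim by auto
qed

text \<open>Blockwise arithmetic reduces the identities between \<open>D_A\<close>, \<open>D_L\<close> and
\<open>D_alpha\<close> to identities for each of the three diagonal blocks.\<close>

lemma diag_block_mat_mult:
  fixes As Bs :: "'a::semiring_0 mat list"
  assumes "list_all2 (\<lambda>A B. dim_col A = dim_row B) As Bs"
  shows "diag_block_mat As * diag_block_mat Bs = diag_block_mat (map2 (*) As Bs)"
  using assms
proof (induction rule: list_all2_induct)
  case Nil
  then show ?case by (intro eq_matI) auto
next
  case (Cons A As B Bs)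
  let ?A = "diag_block_mat As" and ?B = "diag_block_mat Bs"
  have AB: "dim_col ?A = dim_row ?B"
    using Cons(2) by (induction rule: list_all2_induct) (auto simp: Let_def)
  have sizes: "dim_row (diag_block_mat (map2 (*) As Bs)) = dim_row ?A"
       "dim_col (diag_block_mat (map2 (*) As Bs)) = dim_col ?B"
    by (simp_all add: Cons.IH[symmetric])
  show ?case
    unfolding list.map zip_Cons_Cons diag_block_mat.simps Let_def prod.case
    by (subst mult_four_block_mat[of _ "dim_row A" "dim_col A" _ "dim_col ?A" _ "dim_row ?A" _ _
          "dim_col B" _ "dim_col ?B"])
      (use Cons(1) AB sizes Cons.IH in auto)
qed

lemma transpose_diag_block_mat:
  "(diag_block_mat As)\<^sup>T = diag_block_mat (map transpose_mat As)"
proof (induction As)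
  case Nil
  then show ?case by (intro eq_matI) auto
next
  case (Cons A As)
  let ?A = "diag_block_mat As"
  have sizes: "dim_row (diag_block_mat (map transpose_mat As)) = dim_col ?A"
       "dim_col (diag_block_mat (map transpose_mat As)) = dim_row ?A"
    by (simp_all add: Cons.IH[symmetric])
  show ?case
    unfolding list.map diag_block_mat.simps Let_def
    by (subst transpose_four_block_mat[of _ "dim_row A" "dim_col A" _ "dim_col ?A" _ "dim_row ?A"])
      (use sizes Cons.IH in auto)
qed

lemma diag_block_mat_add_smult:
  fixes As Bs :: "'a::semiring_0 mat list"
  assumes "list_all2 (\<lambda>A B. dim_row A = dim_row B \<and> dim_col A = dim_col B) As Bs"
  shows "diag_block_mat As + c \<cdot>\<^sub>m diag_block_mat Bs = diag_block_mat (map2 (\<lambda>A B. A + c \<cdot>\<^sub>m B) As Bs)"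
  using assms
proof (induction rule: list_all2_induct)
  case Nil
  then show ?case by (intro eq_matI) auto
next
  case (Cons A As B Bs)
  let ?A = "diag_block_mat As" and ?B = "diag_block_mat Bs"
  have AB: "dim_col ?A = dim_col ?B" "dim_row ?A = dim_row ?B"
    using Cons(2) by (induction rule: list_all2_induct) (auto simp: Let_def)
  show ?case
    unfolding list.map zip_Cons_Cons diag_block_mat.simps Let_def prod.case
      Cons.IH[symmetric]
    by (rule eq_matI) (use Cons(1) AB in auto)
qed

section \<open>Diagonalization by the generalized singular value decomposition\<close>

text \<open>Gram matrices do not see the orthogonal factor of the decomposition.\<close>

lemma orthogonal_gram:
  assumes "orthogonal_matrix m U" "D \<in> carrier_mat m n" "Y \<in> carrier_mat n n"
  shows "(U * D * Y)\<^sup>T * (U * D * Y) = Y\<^sup>T * (D\<^sup>T * D) * Y"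
proof -
  have U: "U \<in> carrier_mat m m" "U\<^sup>T * U = 1\<^sub>m m"
    using assms(1) by (auto simp: orthogonal_matrix_def)
  have "U\<^sup>T * (U * X) = X" if "dim_row X = m" for X
    using U that by (subst assoc_mult_mat_dim[symmetric]) auto
  then show ?thesis
    using U(1) assms(2,3) by (simp add: transpose_mult_dim assoc_mult_mat_dim)
qed

lemma D_A_carrier:
  "r + q \<le> m \<Longrightarrow> r + q \<le> n \<Longrightarrow> D_A m n r q \<sigma> \<in> carrier_mat m n"
  by (auto simp: D_A_def dim_diag_block_mat mat_diag_def Let_def)

lemma D_L_carrier:
  "r + q \<le> n \<Longrightarrow> n \<le> p + r \<Longrightarrow> D_L p n r q \<rho> \<in> carrier_mat p n"
  by (auto simp: D_L_def dim_diag_block_mat mat_diag_def Let_def)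

lemma D_alpha_carrier:
  "r + q \<le> n \<Longrightarrow> D_alpha n r q \<sigma> \<rho> \<alpha> \<in> carrier_mat n n"
  by (auto simp: D_alpha_def dim_diag_block_mat mat_diag_def Let_def)

lemma transpose_mat_diag [simp]: "(mat_diag n f)\<^sup>T = mat_diag n f"
  by (intro eq_matI) (auto simp: mat_diag_def)

text \<open>The row blocks of \<open>D_A\<close> and \<open>D_L\<close> may have different sizes, but their column blocks
agree. The two Gram matrices therefore have the same block structure, and the blocks add up to
\<open>1 + \<alpha> 0\<close>, \<open>\<sigma>\<^sup>2 + \<alpha> \<rho>\<^sup>2\<close> and
\<open>0 + \<alpha> 1\<close>.\<close>

lemma D_alpha_eq_gram:
  shows "(D_A m n r q \<sigma>)\<^sup>T * D_A m n r q \<sigma> + \<alpha> \<cdot>\<^sub>m ((D_L p n r q \<rho>)\<^sup>T * D_L p n r q \<rho>)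
    = D_alpha n r q \<sigma> \<rho> \<alpha>"
proof -
  have [simp]: "(1::nat) = Suc 0" by simp
  have dim: "dim_row (mat_diag k f) = k" "dim_col (mat_diag k f) = k" for k and f :: "nat \<Rightarrow> real"
    by (simp_all add: mat_diag_def)
  have "1\<^sub>m r + \<alpha> \<cdot>\<^sub>m 0\<^sub>m r r = (1\<^sub>m r :: real mat)" by auto
  moreover have "mat_diag q f + \<alpha> \<cdot>\<^sub>m mat_diag q g = mat_diag q (\<lambda>j. f j + \<alpha> * g j)" for f g
    by (intro eq_matI) (auto simp: mat_diag_def)
  moreover have "0\<^sub>m k k + \<alpha> \<cdot>\<^sub>m 1\<^sub>m k = mat_diag k (\<lambda>_. \<alpha>)" for k
    by (intro eq_matI) (auto simp: mat_diag_def)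
  ultimately show ?thesis
    unfolding D_A_def D_L_def D_alpha_def transpose_diag_block_mat
    by (simp add: diag_block_mat_mult diag_block_mat_add_smult dim power2_eq_square
        del: diag_block_mat.simps)
qed

text \<open>The diagonal entries are positive, those of the middle block because \<open>\<sigma>\<^sub>i > 0\<close> and those of
the last because \<open>\<alpha> > 0\<close>, so they can be inverted one by one.\<close>

lemma D_alpha_minv:
  fixes \<rho> :: "nat \<Rightarrow> real"
  assumes rq: "r + q \<le> n" and \<alpha>: "0 < \<alpha>" and \<sigma>: "\<And>i. i \<in> {r+1..r+q} \<Longrightarrow> 0 < \<sigma> i"
  defines "D \<equiv> D_alpha n r q \<sigma> \<rho> \<alpha>"
  shows "minv D \<in> carrier_mat n n" "D * minv D = 1\<^sub>m n" "minv D * D = 1\<^sub>m n"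
proof -
  define d where "d j = (\<sigma> (r + 1 + j))\<^sup>2 + \<alpha> * (\<rho> (r + 1 + j))\<^sup>2" for j
  let ?E = "diag_block_mat [1\<^sub>m r, mat_diag q (\<lambda>j. inverse (d j)), mat_diag (n - r - q) (\<lambda>_. inverse \<alpha>)]"
  have dim: "dim_row (mat_diag k f) = k" "dim_col (mat_diag k f) = k" for k and f :: "nat \<Rightarrow> real"
    by (simp_all add: mat_diag_def)
  have "d j > 0" if "j < q" for j
    unfolding d_def using \<sigma>[of "r + 1 + j"] that \<alpha> by (intro add_pos_nonneg) auto
  then have one: "mat_diag q (\<lambda>j. d j * inverse (d j)) = 1\<^sub>m q"
    by (intro eq_matI) (auto simp: mat_diag_def less_imp_neq[symmetric])
  have D_eq: "D = diag_block_mat [1\<^sub>m r, mat_diag q d, mat_diag (n - r - q) (\<lambda>_. \<alpha>)]"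
    by (simp add: D_def D_alpha_def d_def[abs_def])
  have "D * ?E = diag_block_mat [1\<^sub>m r, 1\<^sub>m q, 1\<^sub>m (n - r - q)]"
    unfolding D_eq using \<alpha>
    by (subst diag_block_mat_mult) (simp_all add: dim one del: diag_block_mat.simps)
  also have "\<dots> = 1\<^sub>m n"
    using diag_block_one_mat[of "[1\<^sub>m r, 1\<^sub>m q, 1\<^sub>m (n - r - q) :: real mat]"] rq
    by (simp del: diag_block_mat.simps)
  finally have DE: "D * ?E = 1\<^sub>m n" .
  have D: "D \<in> carrier_mat n n"
    unfolding D_def by (rule D_alpha_carrier[OF rq])
  have E: "?E \<in> carrier_mat n n"
    using rq by (auto simp: dim Let_def)
  have "minv D = ?E"
    by (rule minv_eqI[OF D E DE])
  then show "minv D \<in> carrier_mat n n" "D * minv D = 1\<^sub>m n" "minv D * D = 1\<^sub>m n"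
    using D E DE mat_mult_left_right_inverse[OF D E DE] by simp_all
qed

text \<open>The two Gram matrices share the congruence by \<open>Y = Z\<^sup>-\<^sup>1\<close>, so
\<open>G = Y\<^sup>T D\<^sub>\<alpha> Y\<close> and \<open>G\<^sup>-\<^sup>1 = Z D\<^sub>\<alpha>\<^sup>-\<^sup>1 Z\<^sup>T\<close>. In
\<open>G\<^sup>-\<^sup>1 A\<^sup>T\<close> the factor \<open>Z\<^sup>T\<close> then meets the \<open>Y\<^sup>T\<close> of
\<open>A\<^sup>T\<close> and cancels.\<close>

lemma gsvd_minv_gram_mult_transpose:
  assumes gsvd: "gsvd m n p A L r q \<sigma> \<rho> U\<^sub>A U\<^sub>L Z" and \<alpha>: "0 < \<alpha>"
  defines "G \<equiv> A\<^sup>T * A + \<alpha> \<cdot>\<^sub>m (L\<^sup>T * L)"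
  shows "minv G \<in> carrier_mat n n"
    and "minv G * A\<^sup>T = Z * minv (D_alpha n r q \<sigma> \<rho> \<alpha>) * (D_A m n r q \<sigma>)\<^sup>T * U\<^sub>A\<^sup>T"
proof -
  let ?D = "D_alpha n r q \<sigma> \<rho> \<alpha>" and ?DA = "D_A m n r q \<sigma>" and ?DL = "D_L p n r q \<rho>"
  let ?Y = "minv Z"
  note S = gsvd[unfolded gsvd_def]
  have UA: "orthogonal_matrix m U\<^sub>A" "U\<^sub>A \<in> carrier_mat m m" "U\<^sub>A\<^sup>T * U\<^sub>A = 1\<^sub>m m"
    and UL: "orthogonal_matrix p U\<^sub>L"
    using S by (auto simp: orthogonal_matrix_def)
  have Z: "Z \<in> carrier_mat n n" using S by simp
  have Y: "?Y \<in> carrier_mat n n" "Z * ?Y = 1\<^sub>m n" "?Y * Z = 1\<^sub>m n"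
    using S by (auto intro!: invertible_mat_minv)
  have DA: "?DA \<in> carrier_mat m n" and DL: "?DL \<in> carrier_mat p n" and D: "?D \<in> carrier_mat n n"
    using S by (auto intro!: D_A_carrier D_L_carrier D_alpha_carrier)
  have Dinv: "minv ?D \<in> carrier_mat n n" "?D * minv ?D = 1\<^sub>m n" "minv ?D * ?D = 1\<^sub>m n"
    using S \<alpha> by (auto intro!: D_alpha_minv)
  have A: "A = U\<^sub>A * ?DA * ?Y" and L: "L = U\<^sub>L * ?DL * ?Y" using S by auto
  have YZ: "?Y\<^sup>T * Z\<^sup>T = 1\<^sub>m n" "Z\<^sup>T * ?Y\<^sup>T = 1\<^sub>m n"
    using Y(1) Z by (simp_all add: transpose_mult_dim[symmetric] Y(2,3))
  \<comment> \<open>In products nested to the right an inverse pair is not a subterm, so cancellation needs a third factor.\<close>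
  have cancel: "?Y * (Z * X) = X" "?Y\<^sup>T * (Z\<^sup>T * X) = X" "Z\<^sup>T * (?Y\<^sup>T * X) = X"
    "?D * (minv ?D * X) = X" if "dim_row X = n" for X
    using Y Z D Dinv YZ that by (simp_all add: assoc_mult_mat_dim[symmetric])
  have "G = ?Y\<^sup>T * (?DA\<^sup>T * ?DA) * ?Y + \<alpha> \<cdot>\<^sub>m (?Y\<^sup>T * (?DL\<^sup>T * ?DL) * ?Y)"
    unfolding G_def A L
    using orthogonal_gram[OF UA(1) DA Y(1)] orthogonal_gram[OF UL DL Y(1)] by simp
  also have "\<alpha> \<cdot>\<^sub>m (?Y\<^sup>T * (?DL\<^sup>T * ?DL) * ?Y) = ?Y\<^sup>T * (\<alpha> \<cdot>\<^sub>m (?DL\<^sup>T * ?DL)) * ?Y"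
    using DL Y by (simp add: mult_smult_distrib[of _ n n _ n] mult_smult_assoc_mat[of _ n n _ n])
  also have "?Y\<^sup>T * (?DA\<^sup>T * ?DA) * ?Y + ?Y\<^sup>T * (\<alpha> \<cdot>\<^sub>m (?DL\<^sup>T * ?DL)) * ?Y
      = ?Y\<^sup>T * (?DA\<^sup>T * ?DA + \<alpha> \<cdot>\<^sub>m (?DL\<^sup>T * ?DL)) * ?Y"
    using DA DL Y by (simp add: mult_add_distrib_mat[of _ n n _ n] add_mult_distrib_mat[of _ n n _ _ n])
  also have "\<dots> = ?Y\<^sup>T * ?D * ?Y"
    by (simp add: D_alpha_eq_gram)
  finally have G: "G = ?Y\<^sup>T * ?D * ?Y" .
  have "minv G = Z * minv ?D * Z\<^sup>T"
  proof (rule minv_eqI)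
    show "G \<in> carrier_mat n n" "Z * minv ?D * Z\<^sup>T \<in> carrier_mat n n"
      using G Y Z D Dinv by auto
    show "G * (Z * minv ?D * Z\<^sup>T) = 1\<^sub>m n"
      unfolding G using Y Z D Dinv cancel YZ by (simp add: assoc_mult_mat_dim)
  qed
  then show "minv G \<in> carrier_mat n n"
    and "minv G * A\<^sup>T = Z * minv ?D * ?DA\<^sup>T * U\<^sub>A\<^sup>T"
    unfolding A using Y Z D Dinv UA DA cancel
    by (simp_all add: assoc_mult_mat_dim transpose_mult_dim)
qed

section \<open>The solution subspace\<close>

lemma pow_mat_commute:
  assumes "E \<in> carrier_mat n n"
  shows "E ^\<^sub>m i * E = E * E ^\<^sub>m i"
proof (induction i)
  case 0
  then show ?case using assms by simp
next
  case (Suc i)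
  then show ?case using assms pow_carrier_mat[OF assms, of i]
    by (metis assoc_mult_mat pow_mat.simps(2))
qed

theorem proposition3p1:
  fixes m n p k r q :: nat
    and A M L G U\<^sub>A U\<^sub>L Z :: "real mat"
    and b :: "real vec"
    and \<alpha> :: real
    and \<sigma> \<rho> a \<beta> :: "nat \<Rightarrow> real"
    and u w :: "nat \<Rightarrow> real vec"
  assumes "A \<in> carrier_mat m n"
    and "b \<in> carrier_vec m"
    and "sym_psd n M"
    and "L \<in> carrier_mat p n"
    and "p \<le> n"
    and "M = L\<^sup>T * L"
    and "vec_space.rank p L = p"
    and "mat_kernel A \<inter> mat_kernel L = {0\<^sub>v n}"
    and "\<alpha> > 0"
    and "G = A\<^sup>T * A + \<alpha> \<cdot>\<^sub>m M"
    and "gsvd m n p A L r q \<sigma> \<rho> U\<^sub>A U\<^sub>L Z"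
    and "k \<ge> 1"
    and "pgkb m n A G b k u w a \<beta>"
    and "\<forall>i\<in>{1..k}. a i \<noteq> 0 \<and> \<beta> i \<noteq> 0"
  shows "vspan n (set (cols (mat_of_cols n (map w [1..<k+1])))) =
    vspan n ((\<lambda>i. Z * (minv (D_alpha n r q \<sigma> \<rho> \<alpha>) * (D_A m n r q \<sigma>)\<^sup>T * D_A m n r q \<sigma>) ^\<^sub>m i
                   * minv (D_alpha n r q \<sigma> \<rho> \<alpha>) * (D_A m n r q \<sigma>)\<^sup>T * U\<^sub>A\<^sup>T *\<^sub>v b) ` {0..k-1})"
proof -
  interpret vec_space "TYPE(real)" n .
  note A = assms(1) and b = assms(2) and \<alpha> = assms(9) and gsvd = assms(11) and k = assms(12)
    and pgkb = assms(13) and nonzero = assms(14)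
  let ?Dinv = "minv (D_alpha n r q \<sigma> \<rho> \<alpha>)" and ?DA = "D_A m n r q \<sigma>"
  define E where "E = ?Dinv * ?DA\<^sup>T * ?DA"
  define C where "C = minv G * A\<^sup>T * A"
  define y where "y i = Z * E ^\<^sub>m i * ?Dinv * ?DA\<^sup>T * U\<^sub>A\<^sup>T *\<^sub>v b" for i
  note S = gsvd[unfolded gsvd_def]
  note P = pgkb[unfolded pgkb_def]
  have U: "U\<^sub>A \<in> carrier_mat m m" "U\<^sub>A\<^sup>T * U\<^sub>A = 1\<^sub>m m"
    using S by (auto simp: orthogonal_matrix_def)
  have Z: "Z \<in> carrier_mat n n" using S by simp
  have Y: "minv Z \<in> carrier_mat n n" "minv Z * Z = 1\<^sub>m n"
    using S by (auto intro!: invertible_mat_minv)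
  have DA: "?DA \<in> carrier_mat m n" using S by (auto intro!: D_A_carrier)
  have Dinv: "?Dinv \<in> carrier_mat n n" using S \<alpha> by (auto intro!: D_alpha_minv)
  have E: "E \<in> carrier_mat n n" "E ^\<^sub>m i \<in> carrier_mat n n" for i
    using Dinv DA by (auto simp: E_def intro!: pow_carrier_mat)
  have G: "minv G \<in> carrier_mat n n" "minv G * A\<^sup>T = Z * ?Dinv * ?DA\<^sup>T * U\<^sub>A\<^sup>T"
    using gsvd_minv_gram_mult_transpose[OF gsvd \<alpha>] assms(6,10) by simp_all
  have C: "C \<in> carrier_mat n n" using A G(1) by (auto simp: C_def)
  have cancel: "U\<^sub>A\<^sup>T * (U\<^sub>A * X) = X" if "dim_row X = m" for X
    using U that by (simp add: assoc_mult_mat_dim[symmetric])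
  have "A = U\<^sub>A * ?DA * minv Z" using S by simp
  then have C_eq: "C = Z * E * minv Z"
    unfolding C_def G E_def using U Z Y DA Dinv cancel by (simp add: assoc_mult_mat_dim)
  have y_carrier: "y i \<in> carrier_vec n" for i
    unfolding y_def using Z E Dinv DA U b by (intro mult_mat_vec_carrier[of _ n m]) auto
  \<comment> \<open>As \<open>C\<close> is similar to \<open>E\<close> by \<open>Z\<close>, the vectors \<open>y i\<close> are the Krylov sequence of \<open>C\<close>.\<close>
  have y_Suc: "y (Suc i) = C *\<^sub>v y i" for i
  proof -
    have F: "Z * E ^\<^sub>m i * ?Dinv * ?DA\<^sup>T * U\<^sub>A\<^sup>T \<in> carrier_mat n m"
      using Z E Dinv DA U by auto
    have "minv Z * (Z * X) = X" if "dim_row X = n" for X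
      using Y Z that by (simp add: assoc_mult_mat_dim[symmetric])
    then have "C * (Z * E ^\<^sub>m i * ?Dinv * ?DA\<^sup>T * U\<^sub>A\<^sup>T) = Z * (E * E ^\<^sub>m i) * ?Dinv * ?DA\<^sup>T * U\<^sub>A\<^sup>T"
      unfolding C_eq using Z Y E carrier_matD[OF E(2)] Dinv DA U by (simp add: assoc_mult_mat_dim)
    then show ?thesis
      unfolding y_def pow_mat.simps pow_mat_commute[OF E(1)]
      using assoc_mult_mat_vec[OF C F b] by simp
  qed
  have w: "w j \<in> carrier_vec n" if "1 \<le> j" "j \<le> k" for j using P that by auto
  have "y 0 = minv G * A\<^sup>T *\<^sub>v b"
    unfolding y_def G using Z E by simp
  also have "\<dots> = (minv G * A\<^sup>T) *\<^sub>v (\<beta> 1 \<cdot>\<^sub>v u 1)"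
    using P by simp
  also have "\<dots> = \<beta> 1 \<cdot>\<^sub>v (minv G * A\<^sup>T *\<^sub>v u 1)"
    using P k G(1) A by (intro mult_mat_vec[of _ n m]) auto
  also have "minv G * A\<^sup>T *\<^sub>v u 1 = a 1 \<cdot>\<^sub>v w 1"
    using P by simp
  finally have y_0: "y 0 = (\<beta> 1 * a 1) \<cdot>\<^sub>v w 1"
    by (simp add: smult_smult_assoc)
  have "span (w ` {1..k}) = span (y ` {..<k})"
  proof (rule span_three_term_recurrence_eq_krylov[where w = w and y = y and k = k and c = "\<beta> 1 * a 1"
        and \<gamma> = "\<lambda>j. \<beta> (j + 1) * a (j + 1)" and \<delta> = "\<lambda>j. (a j)\<^sup>2 + (\<beta> (j + 1))\<^sup>2"
        and \<epsilon> = "\<lambda>j. a j * \<beta> j", OF C w _ y_carrier y_Suc k y_0])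
    show "w 0 = 0\<^sub>v n" using P by simp
    show "\<beta> 1 * a 1 \<noteq> 0" using nonzero k by auto
    show "\<beta> (j + 1) * a (j + 1) \<noteq> 0 \<and> C *\<^sub>v w j =
        (\<beta> (j + 1) * a (j + 1)) \<cdot>\<^sub>v w (j + 1) + ((a j)\<^sup>2 + (\<beta> (j + 1))\<^sup>2) \<cdot>\<^sub>v w j
          + (a j * \<beta> j) \<cdot>\<^sub>v w (j - 1)" if "1 \<le> j" "j < k" for j
      using pgkb_three_term_recurrence[OF pgkb A G(1) that] nonzero that by (auto simp: C_def)
  qed
  moreover have "set (cols (mat_of_cols n (map w [1..<k+1]))) = w ` {1..k}"
    using w by (subst cols_mat_of_cols) (auto simp: image_iff)
  moreover have "{0..k - 1} = {..<k}" using k by auto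
  ultimately show ?thesis
    by (simp add: y_def E_def)
qed

end
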